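(* Let $O$ be an acyclic orientation of the graph of the $d$-dimensional crosspolytope, whose vertices come in pairs $P_1,\ldots,P_d$ of opposite vertices. Then $O$ is an LP-orientation if and only if there is no nonempty proper subset $I\subsetneq\{1,\ldots,d\}$ such that, with $S=\bigcup_{i\in I}P_i$, every edge between a vertex $x\in S$ and a vertex $y\notin S$ is oriented from $x$ towards $y$.
   Context: The $d$-dimensional crosspolytope is, combinatorially, the simplicial $d$-polytope with $2d$ vertices partitioned into $d$ pairs $P_1,\ldots,P_d$ whose proper faces are exactly the sets of vertices containing at most one element of each pair (e.g. the convex hull of $\pm e_1,\ldots,\pm e_d$ in $\mathbb{R}^d$ with $P_i=\{e_i,-e_i\}$). For $d\ge 2$ its graph has an edge between every two vertices not belonging to the same pair, and no other edges. A realization of the $d$-crosspolytope is a convex polytope $Q\subset\mathbb{R}^d$ combinatorially equivalent to it, i.e. together with an isomorphism of face lattices (so vertices of $Q$ are identified with those of the crosspolytope). An orientation of the graph is acyclic if it has no directed cycle. An orientation $O$ is an LP-orientation (also called "linearly inducible") if there exist a realization $Q\subset\mathbb{R}^d$ and a linear functional $f$ on $\mathbb{R}^d$, taking distinct values at adjacent vertices of $Q$, such that every edge $vw$ is oriented from $v$ to $w$ in $O$ if and only if $f(v)<f(w)$. *)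

theory Defs
  imports "HOL-Analysis.Analysis"
begin

text \<open>
  The index set \<open>{1, \<dots>, d}\<close> of the pairs is the finite type \<^typ>\<open>'n\<close>, so that
  \<open>d = CARD('n) \<ge> 1\<close> and the ambient space of the realizations is \<^typ>\<open>real ^ 'n\<close>.
\<close>

type_synonym 'n cp_vertex = "'n \<times> bool"

definition cp_pair :: "'n \<Rightarrow> 'n cp_vertex set" where
  "cp_pair i = {(i, False), (i, True)}"

text \<open>
  Faces are represented by their vertex sets.  The first disjunct is the improper face; the
  second one gives the proper faces, including the empty one.
\<close>

definition cp_faces :: "'n cp_vertex set set" where
  "cp_faces = {F. F = UNIV \<or> (\<forall>i. card (F \<inter> cp_pair i) \<le> 1)}"

text \<open>
  Edges are the faces with two vertices.  For \<open>d \<ge> 2\<close> they join the vertices of different pairs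
  (lemma \<open>cp_adj_iff\<close> below); for \<open>d = 1\<close> the polytope is a segment, which is its own only edge.
\<close>

definition cp_adj :: "'n cp_vertex \<Rightarrow> 'n cp_vertex \<Rightarrow> bool" where
  "cp_adj v w \<longleftrightarrow> v \<noteq> w \<and> {v, w} \<in> cp_faces"

definition cp_orientation :: "('n cp_vertex \<times> 'n cp_vertex) set \<Rightarrow> bool" where
  "cp_orientation R \<longleftrightarrow>
     (\<forall>v w. (v, w) \<in> R \<longrightarrow> cp_adj v w) \<and>
     (\<forall>v w. cp_adj v w \<longrightarrow> ((v, w) \<in> R \<longleftrightarrow> (w, v) \<notin> R))"

definition face_lattice_iso :: "('a set \<Rightarrow> 'b set) \<Rightarrow> 'a set set \<Rightarrow> 'b set set \<Rightarrow> bool" where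
  "face_lattice_iso \<Phi> L M \<longleftrightarrow>
     bij_betw \<Phi> L M \<and> (\<forall>A\<in>L. \<forall>B\<in>L. A \<subseteq> B \<longleftrightarrow> \<Phi> A \<subseteq> \<Phi> B)"

text \<open>
  \<open>p\<close> is the identification of vertices induced by the isomorphism \<open>\<Phi>\<close>.  That \<open>Q\<close> has
  dimension \<open>d\<close> follows from the existence of \<open>\<Phi>\<close>.
\<close>

definition cp_realization :: "(real ^ 'n) set \<Rightarrow> ('n cp_vertex \<Rightarrow> real ^ 'n) \<Rightarrow> bool" where
  "cp_realization Q p \<longleftrightarrow> polytope Q \<and>
     (\<exists>\<Phi>. face_lattice_iso \<Phi> cp_faces {F. F face_of Q} \<and> (\<forall>v. \<Phi> {v} = {p v}))"

definition LP_orientation :: "('n::finite cp_vertex \<times> 'n cp_vertex) set \<Rightarrow> bool" where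
  "LP_orientation R \<longleftrightarrow>
     (\<exists>(Q :: (real ^ 'n) set) p (f :: real ^ 'n \<Rightarrow> real).
        cp_realization Q p \<and> linear f \<and>
        (\<forall>v w. cp_adj v w \<longrightarrow> f (p v) \<noteq> f (p w)) \<and>
        (\<forall>v w. cp_adj v w \<longrightarrow> ((v, w) \<in> R \<longleftrightarrow> f (p v) < f (p w))))"

lemma cp_adj_iff:
  fixes v w :: "'n::finite cp_vertex"
  assumes "CARD('n) \<ge> 2"
  shows "cp_adj v w \<longleftrightarrow> fst v \<noteq> fst w"
proof -
  have "{v, w} \<noteq> UNIV"
  proof
    assume "{v, w} = UNIV"
    then have "CARD('n \<times> bool) \<le> 2"
      using card_length[of "[v, w]"] by simp
    then show False
      using assms by (simp add: card_prod)
  qed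
  moreover have "(v \<noteq> w \<and> (\<forall>i. card ({v, w} \<inter> cp_pair i) \<le> 1)) \<longleftrightarrow> fst v \<noteq> fst w"
  proof (cases "fst v = fst w")
    case True
    have "{v, w} \<inter> cp_pair (fst v) = {v, w}"
      using True by (cases v; cases w; auto simp: cp_pair_def)
    then have "v \<noteq> w \<Longrightarrow> \<not> card ({v, w} \<inter> cp_pair (fst v)) \<le> 1"
      by simp
    then show ?thesis using True by blast
  next
    case False
    have "{v, w} \<inter> cp_pair i \<subseteq> {if i = fst v then v else w}" for i
      using False by (cases v; cases w; auto simp: cp_pair_def)
    then have "card ({v, w} \<inter> cp_pair i) \<le> 1" for i
      by (metis card_mono finite.emptyI finite_insert is_singletonI is_singleton_altdef)
    then show ?thesis using False by auto
  qed
  ultimately show ?thesis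
    by (auto simp: cp_adj_def cp_faces_def)
qed

end

theory Submission imports Defs begin

text \<open>
  Everything is expressed through slacks, the restrictions of affine functions to the vertices.
  Since every face of a polytope is exposed, a map \<open>p\<close> of the vertices is a realization exactly
  if the zero sets of the nonnegative slacks are the faces of the crosspolytope
  (\<open>cp_realization_iff_slacks\<close>); both directions use this criterion only.

  Necessity.  Suppose that a slack \<open>h\<close> is at most \<open>0\<close> on the pairs in \<open>I\<close> and positive on
  the others.  Tilt it step by step: if it vanishes on a face \<open>F\<close> with supporting slack \<open>l\<close>, subtract
  from \<open>h\<close> the multiple of \<open>l\<close> that makes one more vertex \<open>a\<close> of the pairs in \<open>I\<close> vanish, and
  keeps the others at most \<open>0\<close>; then \<open>F \<union> {a}\<close> is a face.  In the end \<open>F\<close> contains one vertex of each pair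
  in \<open>I\<close>, and some vertex outside \<open>F\<close> still has a value at most \<open>0\<close>.  Adding the smallest
  multiple of \<open>l\<close> that makes \<open>h\<close> nonnegative yields a zero set that contains two opposite vertices but
  misses the pairs outside \<open>I\<close>, which no face does (\<open>no_separating_slack\<close>).

  Sufficiency.  Number the vertices compatibly with the orientation, so that every pair becomes an
  interval of numbers, and order the pairs by their lower ends.  Build the polytope as an iterated
  bipyramid: each new pair spans a segment in a new direction that crosses the hull of the earlier
  vertices, from one side of their span to the other, in a relative interior point.  This
  always gives a crosspolytope (\<open>bipyramid_realization\<close>), and the vertices can be given the values \<open>c\<close>
  of a linear functional whenever the crossing points can have values strictly inside the new
  intervals (\<open>realization_with_values\<close>).  Some of the earlier values are below the lower end of
  the new interval.  If all of them were, the earlier pairs would form a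
  forbidden set \<open>I\<close>.  Hence some are above it, and a suitable crossing value exists.
\<close>

section \<open>Faces of the crosspolytope\<close>

(* A quantifier over vertices is to stay one quantifier instead of being split into two. *)
declare split_paired_All [simp del] split_paired_Ex [simp del]

lemma cp_faces_iff:
  "F \<in> cp_faces \<longleftrightarrow> F = UNIV \<or> (\<forall>i. (i, False) \<notin> F \<or> (i, True) \<notin> F)"
proof -
  have "card (F \<inter> cp_pair i) \<le> 1 \<longleftrightarrow> (i, False) \<notin> F \<or> (i, True) \<notin> F" for i
    by (cases "(i, False) \<in> F"; cases "(i, True) \<in> F") (auto simp: cp_pair_def Int_insert_right)
  then show ?thesis by (simp add: cp_faces_def)
qed

definition opposite :: "'n cp_vertex \<Rightarrow> 'n cp_vertex" where
  "opposite v = (fst v, \<not> snd v)"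

lemma opposite_simps [simp]: "fst (opposite v) = fst v" "opposite v \<noteq> v"
  by (auto simp: opposite_def prod_eq_iff)

lemma same_pair_iff: "fst u = fst v \<longleftrightarrow> u = v \<or> u = opposite v"
  by (cases u; cases v) (auto simp: opposite_def)

lemma opposite_face_UNIV:
  assumes "F \<in> cp_faces" "v \<in> F" "opposite v \<in> F"
  shows "F = UNIV"
  using assms by (cases v; cases "snd v") (auto simp: cp_faces_iff opposite_def)

lemma cp_adj_if_fst_neq: "fst v \<noteq> fst w \<Longrightarrow> cp_adj v w"
  by (auto simp: cp_adj_def cp_faces_iff)

lemma mem_pairs_iff: "x \<in> (\<Union>i\<in>I. cp_pair i) \<longleftrightarrow> fst x \<in> I"
  by (cases x; cases "snd x") (auto simp: cp_pair_def)

lemma finite_argmax: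
  fixes f :: "'a \<Rightarrow> 'b::linorder"
  assumes "finite A" "A \<noteq> {}"
  obtains a where "a \<in> A" "\<And>x. x \<in> A \<Longrightarrow> f x \<le> f a"
proof -
  have "Max (f ` A) \<in> f ` A" using assms by (intro Max_in) auto
  then obtain a where "a \<in> A" "f a = Max (f ` A)" by auto
  then show ?thesis using assms by (intro that[of a]) auto
qed

section \<open>Realizations in terms of slacks\<close>

definition slacks :: "('a \<Rightarrow> 'b::real_inner) \<Rightarrow> ('a \<Rightarrow> real) set" where
  "slacks p = {h. \<exists>a b. \<forall>v. h v = b - a \<bullet> p v}"

lemma slacksI: "(\<And>v. h v = b - a \<bullet> p v) \<Longrightarrow> h \<in> slacks p"
  by (auto simp: slacks_def)

text \<open>Tilting a hyperplane about its intersection with another one.\<close>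

lemma slacks_combine:
  assumes "h \<in> slacks p" "l \<in> slacks p"
  shows "(\<lambda>v. h v + t * l v) \<in> slacks p"
proof -
  obtain a b a' b' where "\<And>v. h v = b - a \<bullet> p v" "\<And>v. l v = b' - a' \<bullet> p v"
    using assms by (auto simp: slacks_def)
  then have "h v + t * l v = (b + t * b') - (a + t *\<^sub>R a') \<bullet> p v" for v
    by (simp add: inner_add_left right_diff_distrib)
  then show ?thesis by (rule slacksI)
qed

lemma nonneg_slack_zero_set_iff:
  "(\<exists>h\<in>slacks p. (\<forall>v. 0 \<le> h v) \<and> F = {v. h v = 0}) \<longleftrightarrow>
   (\<exists>a b. (\<forall>v. a \<bullet> p v \<le> b) \<and> F = {v. a \<bullet> p v = b})"
proof
  assume "\<exists>h\<in>slacks p. (\<forall>v. 0 \<le> h v) \<and> F = {v. h v = 0}"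
  then obtain h where h: "h \<in> slacks p" "\<And>v. 0 \<le> h v" "F = {v. h v = 0}"
    by blast
  then obtain a b where "\<And>v. h v = b - a \<bullet> p v"
    unfolding slacks_def by blast
  with h have "\<forall>v. a \<bullet> p v \<le> b" "F = {v. a \<bullet> p v = b}"
    by auto
  then show "\<exists>a b. (\<forall>v. a \<bullet> p v \<le> b) \<and> F = {v. a \<bullet> p v = b}" by blast
next
  assume "\<exists>a b. (\<forall>v. a \<bullet> p v \<le> b) \<and> F = {v. a \<bullet> p v = b}"
  then obtain a b where "\<forall>v. a \<bullet> p v \<le> b" "F = {v. a \<bullet> p v = b}" by blast
  then show "\<exists>h\<in>slacks p. (\<forall>v. 0 \<le> h v) \<and> F = {v. h v = 0}"
    by (intro bexI[of _ "\<lambda>v. b - a \<bullet> p v"] slacksI) auto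
qed

lemma face_eq_hull_of_vertices:
  fixes p :: "'a::finite \<Rightarrow> 'b::euclidean_space"
  assumes "G face_of convex hull (range p)"
  shows "G = convex hull (p ` {v. p v \<in> G})"
proof
  obtain s where s: "s \<subseteq> range p" "G = convex hull s"
    using face_of_convex_hull_subset[OF _ assms] by (auto simp: finite_imp_compact)
  have "s \<subseteq> p ` {v. p v \<in> G}"
    using s hull_subset[of s convex] by blast
  then show "G \<subseteq> convex hull (p ` {v. p v \<in> G})"
    using s(2) hull_mono by blast
  show "convex hull (p ` {v. p v \<in> G}) \<subseteq> G"
    using face_of_imp_convex[OF assms] by (intro hull_minimal) auto
qed

text \<open>
  This replaces lattices of faces by inequalities at the vertices.  Given the lattice isomorphism,
  a face contains the point \<open>p v\<close> exactly if its combinatorial counterpart contains \<open>v\<close>, because \<open>{v}\<close>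
  is mapped to \<open>{p v}\<close>; in particular all extreme points are of this form.  Conversely, taking
  hulls is the required isomorphism, since every face of the hull is exposed.
\<close>

lemma cp_realization_iff_slacks:
  fixes p :: "'n::finite cp_vertex \<Rightarrow> real ^ 'n"
  shows "cp_realization Q p \<longleftrightarrow> Q = convex hull (range p) \<and>
    (\<forall>F. F \<in> cp_faces \<longleftrightarrow> (\<exists>h\<in>slacks p. (\<forall>v. 0 \<le> h v) \<and> F = {v. h v = 0}))"
    (is "_ \<longleftrightarrow> _ \<and> (\<forall>F. _ \<longleftrightarrow> ?exposed F)")
proof (rule iffI)
  assume "cp_realization Q p"
  then obtain \<Phi> where poly: "polytope Q" and iso: "face_lattice_iso \<Phi> cp_faces {F. F face_of Q}"
    and sing: "\<And>v. \<Phi> {v} = {p v}"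
    by (auto simp: cp_realization_def)
  have bij: "bij_betw \<Phi> cp_faces {F. F face_of Q}"
    using iso by (simp add: face_lattice_iso_def)
  have ord: "A \<subseteq> B \<longleftrightarrow> \<Phi> A \<subseteq> \<Phi> B" if "A \<in> cp_faces" "B \<in> cp_faces" for A B
    using iso that by (simp add: face_lattice_iso_def)
  have vertex: "{v} \<in> cp_faces" for v :: "'n cp_vertex"
    by (auto simp: cp_faces_iff)
  have mem: "p v \<in> \<Phi> F \<longleftrightarrow> v \<in> F" if "F \<in> cp_faces" for v F
    using ord[OF vertex that] sing[of v] by simp
  have face: "\<Phi> F face_of Q" if "F \<in> cp_faces" for F
    using bij that by (auto simp: bij_betw_def)
  have ex: "\<exists>F\<in>cp_faces. G = \<Phi> F" if "G face_of Q" for G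
  proof -
    have "G \<in> \<Phi> ` cp_faces" using bij that by (simp add: bij_betw_def)
    then show ?thesis by blast
  qed
  have conv: "convex Q" "compact Q"
    using poly by (auto simp: polytope_imp_convex polytope_imp_compact)
  have pQ: "p v \<in> Q" for v
    using face_of_imp_subset[OF face[OF vertex[of v]]] sing[of v] by simp
  \<comment> \<open>The empty face of \<open>Q\<close> can only come from the empty face.\<close>
  have nonempty: "F \<noteq> {}" if "\<Phi> F \<noteq> {}" "F \<in> cp_faces" for F
  proof
    assume "F = {}"
    obtain F' where F': "F' \<in> cp_faces" "\<Phi> F' = {}"
      using ex[of "{}"] by auto
    then have "F' = {}" using mem[OF F'(1)] by auto
    then show False using that F' \<open>F = {}\<close> by simp
  qed
  have "x \<in> range p" if "x extreme_point_of Q" for x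
  proof -
    have "{x} face_of Q" using that by (simp add: face_of_singleton)
    then obtain F where F: "F \<in> cp_faces" "{x} = \<Phi> F" using ex by blast
    then obtain v where "v \<in> F" using nonempty[OF _ F(1)] F(2) by blast
    then have "p v \<in> {x}" using mem[OF F(1)] F(2) by simp
    then show ?thesis by blast
  qed
  then have "Q \<subseteq> convex hull (range p)"
    using Krein_Milman_Minkowski[OF conv(2,1)] hull_mono[of "{x. x extreme_point_of Q}" "range p" convex]
    by auto
  moreover have "convex hull (range p) \<subseteq> Q"
    using pQ conv by (intro hull_minimal) auto
  ultimately have Q: "Q = convex hull (range p)" by blast
  have "F \<in> cp_faces \<longleftrightarrow> ?exposed F" for F
  proof
    assume F: "F \<in> cp_faces"
    have "\<Phi> F exposed_face_of Q"
      using face[OF F] exposed_face_of_polyhedron[OF polytope_imp_polyhedron[OF poly]] by simp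
    then obtain a b where ab: "Q \<subseteq> {x. a \<bullet> x \<le> b}" "\<Phi> F = Q \<inter> {x. a \<bullet> x = b}"
      by (auto simp: exposed_face_of_def)
    have "v \<in> F \<longleftrightarrow> a \<bullet> p v = b" for v
      using mem[OF F, of v] pQ[of v] ab(2) by auto
    then have "F = {v. a \<bullet> p v = b}" by blast
    then show "?exposed F"
      unfolding nonneg_slack_zero_set_iff using ab(1) pQ by blast
  next
    assume "?exposed F"
    then obtain a b where ab: "\<And>v. a \<bullet> p v \<le> b" "F = {v. a \<bullet> p v = b}"
      unfolding nonneg_slack_zero_set_iff by blast
    have "Q \<subseteq> {x. a \<bullet> x \<le> b}"
      unfolding Q using ab(1) by (intro hull_minimal) (auto simp: convex_halfspace_le)
    then have "(Q \<inter> {x. a \<bullet> x = b}) face_of Q"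
      using conv by (intro face_of_Int_supporting_hyperplane_le) auto
    then obtain F' where F': "F' \<in> cp_faces" "Q \<inter> {x. a \<bullet> x = b} = \<Phi> F'"
      using ex by blast
    have "v \<in> F' \<longleftrightarrow> v \<in> F" for v
      using mem[OF F'(1), of v] F'(2) pQ[of v] ab(2) by auto
    then show "F \<in> cp_faces" using F'(1) by (metis subsetI subset_antisym)
  qed
  with Q show "Q = convex hull (range p) \<and> (\<forall>F. F \<in> cp_faces \<longleftrightarrow> ?exposed F)"
    by blast
next
  assume "Q = convex hull (range p) \<and> (\<forall>F. F \<in> cp_faces \<longleftrightarrow> ?exposed F)"
  then have Q: "Q = convex hull (range p)" and faces: "\<And>F. F \<in> cp_faces \<longleftrightarrow> ?exposed F"
    by auto
  have poly: "polytope Q"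
    unfolding Q by (simp add: polytope_convex_hull)
  have pQ: "p v \<in> Q" for v
    unfolding Q by (simp add: hull_inc)
  let ?\<Phi> = "\<lambda>F. convex hull (p ` F)"
  have hull: "?\<Phi> F face_of Q \<and> (\<forall>v. p v \<in> ?\<Phi> F \<longleftrightarrow> v \<in> F)" if F: "F \<in> cp_faces" for F
  proof -
    obtain a b where ab: "\<And>v. a \<bullet> p v \<le> b" "F = {v. a \<bullet> p v = b}"
      using F[unfolded faces] unfolding nonneg_slack_zero_set_iff by blast
    have "Q \<subseteq> {x. a \<bullet> x \<le> b}"
      unfolding Q using ab(1) by (intro hull_minimal) (auto simp: convex_halfspace_le)
    then have face: "(Q \<inter> {x. a \<bullet> x = b}) face_of Q"
      using poly polytope_imp_convex by (intro face_of_Int_supporting_hyperplane_le) auto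
    have vertices: "{v. p v \<in> Q \<inter> {x. a \<bullet> x = b}} = F"
      using pQ ab(2) by auto
    have "Q \<inter> {x. a \<bullet> x = b} = ?\<Phi> F"
      using face_eq_hull_of_vertices[OF face[unfolded Q], folded Q, unfolded vertices] .
    then show ?thesis using face pQ ab(2) by auto
  qed
  have ord: "A \<subseteq> B \<longleftrightarrow> ?\<Phi> A \<subseteq> ?\<Phi> B" if "A \<in> cp_faces" "B \<in> cp_faces" for A B
  proof
    assume "A \<subseteq> B"
    then show "?\<Phi> A \<subseteq> ?\<Phi> B" by (intro hull_mono image_mono)
  next
    assume sub: "?\<Phi> A \<subseteq> ?\<Phi> B"
    show "A \<subseteq> B"
    proof
      fix v
      assume "v \<in> A"
      then have "p v \<in> ?\<Phi> B" using hull[OF that(1)] sub by blast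
      then show "v \<in> B" using hull[OF that(2)] by blast
    qed
  qed
  have "\<exists>F\<in>cp_faces. G = ?\<Phi> F" if G: "G face_of Q" for G
  proof -
    have "G exposed_face_of Q"
      using G exposed_face_of_polyhedron[OF polytope_imp_polyhedron[OF poly]] by simp
    then obtain a b where ab: "Q \<subseteq> {x. a \<bullet> x \<le> b}" "G = Q \<inter> {x. a \<bullet> x = b}"
      by (auto simp: exposed_face_of_def)
    have "{v. p v \<in> G} = {v. a \<bullet> p v = b}"
      using ab(2) pQ by simp
    then have "?exposed {v. p v \<in> G}"
      unfolding nonneg_slack_zero_set_iff using ab(1) pQ by blast
    then have "{v. p v \<in> G} \<in> cp_faces" using faces by blast
    then show ?thesis
      by (intro bexI[of _ "{v. p v \<in> G}"] face_eq_hull_of_vertices[OF G[unfolded Q]])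
  qed
  then have "{F. F face_of Q} \<subseteq> ?\<Phi> ` cp_faces" by blast
  moreover have "?\<Phi> ` cp_faces \<subseteq> {F. F face_of Q}" using hull by blast
  moreover have "inj_on ?\<Phi> cp_faces"
  proof (rule inj_onI)
    fix A B
    assume "A \<in> cp_faces" "B \<in> cp_faces" "?\<Phi> A = ?\<Phi> B"
    then show "A = B" using ord[of A B] ord[of B A] by simp
  qed
  ultimately have "face_lattice_iso ?\<Phi> cp_faces {F. F face_of Q}"
    using ord by (simp add: face_lattice_iso_def bij_betw_def subset_antisym)
  then show "cp_realization Q p"
    unfolding cp_realization_def using poly by (intro conjI exI[of _ ?\<Phi>]) auto
qed

section \<open>Separated pairs exclude a realization\<close>

text \<open>
  The case of interest is \<open>F = {}\<close>; a general \<open>F\<close> makes the tilting an induction on the number of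
  pairs in \<open>I\<close> that \<open>F\<close> does not meet.  The vertex \<open>b\<close> outside \<open>F\<close> is the witness that
  keeps the last step from being empty: if \<open>F\<close> meets all pairs in \<open>I\<close>, then a slack that
  vanishes on \<open>F\<close> and is positive elsewhere exists, and \<open>b\<close> says that \<open>h\<close> is not one.
\<close>

lemma no_separating_slack:
  fixes V :: "('n::finite cp_vertex \<Rightarrow> real) set" and I :: "'n set"
  assumes combine: "\<And>h l t. h \<in> V \<Longrightarrow> l \<in> V \<Longrightarrow> (\<lambda>v. h v + t * l v) \<in> V"
    and faces: "\<And>F. F \<in> cp_faces \<longleftrightarrow> (\<exists>h\<in>V. (\<forall>v. 0 \<le> h v) \<and> F = {v. h v = 0})"
    and "I \<noteq> UNIV"
    and "F \<in> cp_faces" "h \<in> V" "\<And>v. v \<in> F \<Longrightarrow> h v = 0"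
    and "\<And>v. fst v \<in> I - fst ` F \<Longrightarrow> h v \<le> 0"
    and "\<And>v. fst v \<notin> I \<Longrightarrow> 0 < h v"
    and "b \<notin> F" "h b \<le> 0"
  shows False
  using assms(4-)
proof (induction "card (I - fst ` F)" arbitrary: F h b rule: less_induct)
  case less
  obtain l where l: "l \<in> V" "\<And>v. 0 \<le> l v" "F = {v. l v = 0}"
    using less.prems(1) faces by blast
  then have lpos: "0 < l v" if "v \<notin> F" for v
    using that l(2)[of v] unfolding l(3) by (metis mem_Collect_eq order_le_less)
  show False
  proof (cases "I \<subseteq> fst ` F")
    case False
    let ?T = "{v :: 'n cp_vertex. fst v \<in> I - fst ` F}"
    have TF: "v \<notin> F" if "v \<in> ?T" for v
      using that by auto
    obtain i where "i \<in> I - fst ` F" using False by blast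
    then have "(i, True) \<in> ?T" by simp
    then have T: "?T \<noteq> {}" by blast
    obtain a where a: "a \<in> ?T" and max: "\<And>v. v \<in> ?T \<Longrightarrow> h v / l v \<le> h a / l a"
      using finite_argmax[OF finite T, of "\<lambda>v. h v / l v"] by blast
    \<comment> \<open>The ratio is at most \<open>0\<close>, so subtracting \<open>m * l\<close> cannot hurt the positive values outside \<open>I\<close>.\<close>
    define m where "m = h a / l a"
    have m: "m \<le> 0"
      unfolding m_def using less.prems(4)[of a] a lpos[OF TF[OF a]] by (simp add: divide_nonpos_pos)
    let ?h = "\<lambda>v. h v + (- m) * l v" and ?F = "insert a F"
    have h_T: "?h v \<le> 0" if "v \<in> ?T" for v
      using max[OF that] lpos[OF TF[OF that]] by (simp add: m_def[symmetric] pos_divide_le_eq)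
    have F: "?F \<in> cp_faces"
    proof -
      have "F \<noteq> UNIV" using TF[OF a] by auto
      then have "\<forall>i. (i, False) \<notin> F \<or> (i, True) \<notin> F" using less.prems(1) cp_faces_iff by blast
      moreover have "(fst a, c) \<notin> F" for c using TF[of "(fst a, c)"] a by simp
      ultimately show ?thesis
        unfolding cp_faces_iff by (cases a) auto
    qed
    have card: "card (I - fst ` ?F) < card (I - fst ` F)"
      using a by (intro psubset_card_mono) auto
    \<comment> \<open>The new witness is the vertex opposite to \<open>a\<close>, whose pair was not met by \<open>F\<close> either.\<close>
    show False
    proof (rule less.hyps[OF card F, of ?h "opposite a"])
      show "?h \<in> V" using combine[OF less.prems(2) l(1)] .
      show "?h v = 0" if "v \<in> ?F" for v
      proof (cases "v = a")
        case True
        then show ?thesis using lpos[OF TF[OF a]] by (simp add: m_def)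
      next
        case False
        then have "h v = 0" "l v = 0" using that less.prems(3) l(3) by blast+
        then show ?thesis by simp
      qed
      show "?h v \<le> 0" if "fst v \<in> I - fst ` ?F" for v
        using that h_T by auto
      show "0 < ?h v" if "fst v \<notin> I" for v
        using less.prems(5)[OF that] mult_nonpos_nonneg[OF m l(2)[of v]] by simp
      show "opposite a \<notin> ?F" using TF[of "opposite a"] a by simp
      show "?h (opposite a) \<le> 0" using a by (intro h_T) simp
    qed
  next
    case True
    have F: "- F \<noteq> {}" using less.prems(6) by blast
    obtain x where x: "x \<notin> F" and max: "\<And>v. v \<notin> F \<Longrightarrow> - h v / l v \<le> - h x / l x"
      using finite_argmax[OF finite F, of "\<lambda>v. - h v / l v"] by auto
    \<comment> \<open>The least \<open>t\<close> for which \<open>h + t * l\<close> is nonnegative; the witness \<open>b\<close> gives \<open>0 \<le> t\<close>.\<close>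
    define t where "t = - h x / l x"
    have t: "0 \<le> t"
      using max[OF less.prems(6)] less.prems(7) lpos[OF less.prems(6)]
      by (smt (verit) divide_nonneg_pos t_def)
    let ?g = "\<lambda>v. h v + t * l v"
    have nonneg: "0 \<le> ?g v" for v
    proof (cases "v \<in> F")
      case True
      then have "h v = 0" "l v = 0" using less.prems(3) l(3) by blast+
      then show ?thesis by simp
    next
      case False
      have "- h v \<le> t * l v"
        using max[OF False] unfolding t_def[symmetric] pos_divide_le_eq[OF lpos[OF False]] .
      then show ?thesis by simp
    qed
    have gx: "?g x = 0" using lpos[OF x] by (simp add: t_def)
    have "h x \<le> 0" using gx t l(2)[of x] by (smt (verit) mult_nonneg_nonneg)
    then have "fst x \<in> I" using less.prems(5)[of x] by fastforce
    then obtain v where "v \<in> F" "fst v = fst x" using True by fastforce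
    \<comment> \<open>The pair of \<open>x\<close> meets \<open>F\<close>, but not in \<open>x\<close>, so a pair of opposite vertices becomes zero.\<close>
    then have "opposite x \<in> F" using x by (auto simp: same_pair_iff)
    then have "h (opposite x) = 0" "l (opposite x) = 0" using less.prems(3) l(3) by blast+
    then have "?g (opposite x) = 0" by simp
    moreover have "{v. ?g v = 0} \<in> cp_faces"
      unfolding faces using nonneg combine[OF less.prems(2) l(1)] by (intro bexI[of _ ?g]) auto
    ultimately have "{v. ?g v = 0} = UNIV"
      using opposite_face_UNIV[of "{v. ?g v = 0}" x] gx by simp
    then have "?g (j, True) = 0" for j
      using UNIV_I[of "(j, True)"] by (metis (mono_tags, lifting) mem_Collect_eq)
    moreover obtain j where "j \<notin> I" using \<open>I \<noteq> UNIV\<close> by blast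
    then have "0 < h (j, True)" using less.prems(5)[of "(j, True)"] by simp
    ultimately show False
      using mult_nonneg_nonneg[OF t l(2)[of "(j, True)"]] by (metis add_pos_nonneg less_irrefl)
  qed
qed

text \<open>
  If all edges led out of the pairs in \<open>I\<close>, the functional minus its largest value on these pairs
  would be a separating slack.
\<close>

lemma LP_orientation_not_separated:
  fixes R :: "('n::finite cp_vertex \<times> 'n cp_vertex) set"
  assumes "LP_orientation R" "I \<noteq> {}" "I \<noteq> UNIV"
  shows "\<exists>x y. fst x \<in> I \<and> fst y \<notin> I \<and> (x, y) \<notin> R"
proof (rule ccontr)
  assume "\<nexists>x y. fst x \<in> I \<and> fst y \<notin> I \<and> (x, y) \<notin> R"
  then have R: "(x, y) \<in> R" if "fst x \<in> I" "fst y \<notin> I" for x y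
    using that by blast
  obtain Q p and f :: "real ^ 'n \<Rightarrow> real" where real: "cp_realization Q p" and f: "linear f"
    and inc: "\<And>v w. cp_adj v w \<Longrightarrow> (v, w) \<in> R \<longleftrightarrow> f (p v) < f (p w)"
    using assms(1) unfolding LP_orientation_def by blast
  let ?S = "{v :: 'n cp_vertex. fst v \<in> I}"
  obtain i where "i \<in> I" using assms(2) by blast
  then have "(i, True) \<in> ?S" by simp
  then have S: "?S \<noteq> {}" by blast
  obtain b where b: "b \<in> ?S" and max: "\<And>v. v \<in> ?S \<Longrightarrow> f (p v) \<le> f (p b)"
    using finite_argmax[OF finite S, of "\<lambda>v. f (p v)"] by blast
  let ?h = "\<lambda>v. f (p v) - f (p b)"
  show False
  proof (rule no_separating_slack[where V = "slacks p" and I = I and F = "{}" and h = ?h and b = b])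
    show "?h \<in> slacks p"
      using adjoint_works[OF f, of _ 1]
      by (intro slacksI[where a = "- adjoint f 1" and b = "- f (p b)"]) (simp add: inner_commute)
    show "0 < ?h v" if "fst v \<notin> I" for v
    proof -
      have "fst b \<noteq> fst v" using b that by auto
      then show ?thesis using R[of b v] b that inc[OF cp_adj_if_fst_neq] by simp
    qed
    show "(\<lambda>v. h v + t * l v) \<in> slacks p" if "h \<in> slacks p" "l \<in> slacks p" for h l t
      using slacks_combine[OF that] .
    show "F \<in> cp_faces \<longleftrightarrow> (\<exists>h\<in>slacks p. (\<forall>v. 0 \<le> h v) \<and> F = {v. h v = 0})" for F
      using real unfolding cp_realization_iff_slacks by blast
    show "{} \<in> cp_faces" by (simp add: cp_faces_iff)
    show "?h v \<le> 0" if "fst v \<in> I - fst ` {}" for v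
      using max that by simp
  qed (use assms b in simp_all)
qed

section \<open>Iterated bipyramids\<close>

definition earlier :: "('n \<Rightarrow> nat) \<Rightarrow> 'n \<Rightarrow> 'n cp_vertex set" where
  "earlier rk i = {u. rk (fst u) < rk i}"

text \<open>
  The segment of the pair \<open>i\<close> has the direction \<open>axis i 1\<close>.  It crosses the span of the earlier vertices
  in their convex combination with the weights \<open>w i\<close>, which are all positive, so that the point
  is in the relative interior of their hull.  The coordinates \<open>r\<close> of the two vertices along the segment have
  opposite signs, so that the point is also interior to the segment.  For the first pair the
  sum is empty and the segment crosses the origin.
\<close>

locale iterated_bipyramid =
  fixes rk :: "'n::finite \<Rightarrow> nat" and w :: "'n \<Rightarrow> 'n cp_vertex \<Rightarrow> real"
    and r :: "'n cp_vertex \<Rightarrow> real" and p :: "'n cp_vertex \<Rightarrow> real ^ 'n"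
  assumes inj_rk: "inj rk"
    and w_pos: "u \<in> earlier rk i \<Longrightarrow> 0 < w i u"
    and w_sum: "earlier rk i \<noteq> {} \<Longrightarrow> sum (w i) (earlier rk i) = 1"
    and r_sign: "r (i, False) * r (i, True) < 0"
    and p_eq: "p v = (\<Sum>u\<in>earlier rk (fst v). w (fst v) u *\<^sub>R p u) + r v *\<^sub>R axis (fst v) 1"
begin

definition base :: "'n \<Rightarrow> real ^ 'n" where
  "base i = (\<Sum>u\<in>earlier rk i. w i u *\<^sub>R p u)"

lemma r_sign_opposite: "r v * r (opposite v) < 0"
  using r_sign[of "fst v"] by (cases v; cases "snd v") (auto simp: opposite_def mult.commute)

lemma inner_p: "a \<bullet> p v = a \<bullet> base (fst v) + r v * a $ fst v"
  by (subst p_eq) (simp add: base_def inner_add_right inner_axis)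

text \<open>
  Affine functions respect the convex combination; the first pair is excluded because its
  empty weights do not sum to \<open>1\<close>.
\<close>

lemma slack_base:
  assumes "earlier rk i \<noteq> {}"
  shows "b - a \<bullet> base i = (\<Sum>u\<in>earlier rk i. w i u * (b - a \<bullet> p u))"
proof -
  have "(\<Sum>u\<in>earlier rk i. w i u * (b - a \<bullet> p u)) = sum (w i) (earlier rk i) * b - a \<bullet> base i"
    by (simp add: base_def inner_sum_right right_diff_distrib sum_subtractf sum_distrib_right)
  then show ?thesis using w_sum[OF assms] by simp
qed

lemma p_triangular: "rk (fst v) < rk j \<Longrightarrow> p v $ j = 0"
proof (induction "rk (fst v)" arbitrary: v rule: less_induct)
  case less
  have "p u $ j = 0" if "u \<in> earlier rk (fst v)" for u
    using that less by (auto simp: earlier_def)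
  then show ?case
    using less.prems by (subst p_eq) (auto simp: axis_def)
qed

text \<open>
  The supporting hyperplane \<open>a \<bullet> x = 1\<close> of \<open>F\<close> is built pair by pair, by choosing the coordinate of
  \<open>a\<close> along the new direction.  The crossing point has a value below \<open>1\<close>: among the earlier vertices some
  are not in \<open>F\<close>, and all have positive weight.  If a vertex of the new pair is in
  \<open>F\<close>, then the coordinate is chosen to give it the value \<open>1\<close>, and the opposite vertex, on the other side of the
  crossing point, falls below \<open>1\<close>; otherwise the value is constant on the segment.
\<close>

lemma supporting_vector_below_rank:
  assumes F: "\<And>i. (i, False) \<notin> F \<or> (i, True) \<notin> F"
  shows "\<exists>a. \<forall>v. rk (fst v) < k \<longrightarrow> a \<bullet> p v \<le> 1 \<and> (a \<bullet> p v = 1 \<longleftrightarrow> v \<in> F)"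
proof (induction k)
  case 0
  show ?case by simp
next
  case (Suc k)
  then obtain a where a: "\<And>v. rk (fst v) < k \<Longrightarrow> a \<bullet> p v \<le> 1 \<and> (a \<bullet> p v = 1 \<longleftrightarrow> v \<in> F)"
    by blast
  show ?case
  proof (cases "\<exists>i. rk i = k")
    case False
    then show ?thesis using a by (metis less_SucE)
  next
    case True
    then obtain i where i: "rk i = k" by blast
    have base_lt: "a \<bullet> base i < 1"
    proof (cases "earlier rk i = {}")
      case True
      then show ?thesis by (simp add: base_def)
    next
      case False
      then obtain u where u: "u \<in> earlier rk i" by blast
      obtain u' where u': "u' \<in> earlier rk i" "u' \<notin> F"
        using u F[of "fst u"] by (auto simp: earlier_def)
      have "0 < (\<Sum>u\<in>earlier rk i. w i u * (1 - a \<bullet> p u))"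
      proof (rule sum_pos2[OF _ u'(1)])
        have "a \<bullet> p u' \<noteq> 1" "a \<bullet> p u' \<le> 1" using a[of u'] u' i by (auto simp: earlier_def)
        then show "0 < w i u' * (1 - a \<bullet> p u')" using w_pos[OF u'(1)] by simp
        show "0 \<le> w i u * (1 - a \<bullet> p u)" if "u \<in> earlier rk i" for u
          using w_pos[OF that] a[of u] that i by (simp add: earlier_def)
      qed simp
      then show ?thesis using slack_base[OF False, of 1 a] by simp
    qed
    define \<delta> where "\<delta> = (if (i, True) \<in> F then (1 - a \<bullet> base i) / r (i, True)
       else if (i, False) \<in> F then (1 - a \<bullet> base i) / r (i, False) else 0)"
    have r_nz: "r v \<noteq> 0" for v using r_sign_opposite[of v] by auto
    \<comment> \<open>Earlier vertices have coordinate \<open>0\<close> in direction \<open>i\<close>, so their values do not change.\<close>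
    define a' where "a' = a + (\<delta> - a $ i) *\<^sub>R axis i 1"
    have earlier: "a' \<bullet> p v = a \<bullet> p v" if "rk (fst v) < k" for v
      using p_triangular[of v i] that i by (simp add: a'_def inner_add_left inner_axis')
    have "a' \<bullet> base i = a \<bullet> base i"
      unfolding base_def inner_sum_right using earlier i by (auto simp: earlier_def)
    moreover have "a' $ i = \<delta>" by (simp add: a'_def)
    ultimately have at_i: "a' \<bullet> p (i, c) = a \<bullet> base i + r (i, c) * \<delta>" for c
      by (simp add: inner_p)
    have ratio: "r (i, \<not> c) * ((1 - a \<bullet> base i) / r (i, c)) < 0" for c
    proof -
      have "r (i, \<not> c) / r (i, c) < 0"
        using r_sign_opposite[of "(i, c)"] by (auto simp: opposite_def divide_less_0_iff mult_less_0_iff)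
      then have "r (i, \<not> c) / r (i, c) * (1 - a \<bullet> base i) < 0"
        using base_lt by (intro mult_neg_pos) auto
      then show ?thesis by (simp add: mult.commute)
    qed
    have new: "a' \<bullet> p (i, c) \<le> 1 \<and> (a' \<bullet> p (i, c) = 1 \<longleftrightarrow> (i, c) \<in> F)" for c
      unfolding at_i using F[of i] ratio[of True] ratio[of False] base_lt r_nz
      by (cases c) (auto simp: \<delta>_def)
    have "a' \<bullet> p v \<le> 1 \<and> (a' \<bullet> p v = 1 \<longleftrightarrow> v \<in> F)" if "rk (fst v) < Suc k" for v
    proof (cases "rk (fst v) < k")
      case True
      then show ?thesis using earlier a by simp
    next
      case False
      then have "fst v = i" using that i inj_rk by (auto simp: inj_def less_Suc_eq)
      then show ?thesis using new[of "snd v"] by (cases v) auto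
    qed
    then show ?thesis by blast
  qed
qed

text \<open>
  A supporting hyperplane that contains a segment contains its crossing point, hence all earlier vertices,
  since their weights are positive.  Conversely, if it contains all vertices before a pair, then
  it contains the crossing point of that pair, which is interior to the segment, hence the
  segment.  So a zero pair spreads to all vertices, first downwards and then upwards.
\<close>

lemma slack_zero_on_pair:
  assumes nonneg: "\<And>v. 0 \<le> b - a \<bullet> p v"
    and zero: "b - a \<bullet> p (i, False) = 0" "b - a \<bullet> p (i, True) = 0"
  shows "b - a \<bullet> p v = 0"
proof -
  let ?h = "\<lambda>v. b - a \<bullet> p v"
  have h: "?h v = (b - a \<bullet> base (fst v)) - r v * a $ fst v" for v
    by (simp add: inner_p)
  have "r (i, True) \<noteq> r (i, False)"
    using r_sign[of i] by (metis mult_less_0_iff not_less_iff_gr_or_eq)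
  moreover have base_i: "b - a \<bullet> base i = r (i, c) * a $ i" for c
  proof -
    have "b - a \<bullet> p (i, c) = 0" using zero by (cases c) simp_all
    then show ?thesis using h[of "(i, c)", unfolded fst_conv] by linarith
  qed
  ultimately have "a $ i = 0" by (metis mult_cancel_right)
  then have base_i: "b - a \<bullet> base i = 0"
    using base_i by simp
  have below: "?h u = 0" if u: "u \<in> earlier rk i" for u
  proof -
    have "(\<Sum>u\<in>earlier rk i. w i u * ?h u) = 0"
      using slack_base[of i b a] base_i u by auto
    then have "w i u * ?h u = 0"
      using u nonneg by (subst (asm) sum_nonneg_eq_0_iff) (auto intro!: mult_nonneg_nonneg less_imp_le[OF w_pos])
    then show ?thesis using w_pos[OF u] by simp
  qed
  show ?thesis
  proof (induction "rk (fst v)" arbitrary: v rule: less_induct)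
    case less
    consider "rk (fst v) < rk i" | "fst v = i" | "rk i < rk (fst v)"
      using inj_rk by (metis injD linorder_neqE_nat)
    then show ?case
    proof cases
      case 1
      then show ?thesis using below by (simp add: earlier_def)
    next
      case 2
      then show ?thesis using zero by (cases v; cases "snd v") auto
    next
      case 3
      then have "(i, True) \<in> earlier rk (fst v)" by (simp add: earlier_def)
      then have "earlier rk (fst v) \<noteq> {}" by blast
      then have "b - a \<bullet> base (fst v) = 0"
        using slack_base[of "fst v" b a] less by (auto simp: earlier_def)
      then have "r v * a $ fst v \<le> 0" "r (opposite v) * a $ fst v \<le> 0"
        using h[of v] h[of "opposite v"] nonneg[of v] nonneg[of "opposite v"] by auto
      then have "a $ fst v = 0"
        using r_sign_opposite[of v] by (auto simp: mult_le_0_iff mult_less_0_iff)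
      then show ?thesis using h[of v] \<open>b - a \<bullet> base (fst v) = 0\<close> by simp
    qed
  qed
qed

theorem bipyramid_realization: "cp_realization (convex hull (range p)) p"
  unfolding cp_realization_iff_slacks nonneg_slack_zero_set_iff
proof (intro conjI allI iffI refl)
  fix F :: "'n cp_vertex set"
  assume "F \<in> cp_faces"
  then consider "F = UNIV" | "\<And>i. (i, False) \<notin> F \<or> (i, True) \<notin> F"
    by (auto simp: cp_faces_iff)
  then show "\<exists>a b. (\<forall>v. a \<bullet> p v \<le> b) \<and> F = {v. a \<bullet> p v = b}"
  proof cases
    case 1
    then show ?thesis
      by (intro exI[of _ 0]) simp
  next
    case 2
    obtain a where a: "\<And>v. rk (fst v) < Suc (Max (range rk)) \<Longrightarrow>
        a \<bullet> p v \<le> 1 \<and> (a \<bullet> p v = 1 \<longleftrightarrow> v \<in> F)"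
      using supporting_vector_below_rank[OF 2] by blast
    then have "a \<bullet> p v \<le> 1 \<and> (a \<bullet> p v = 1 \<longleftrightarrow> v \<in> F)" for v
      by (simp add: less_Suc_eq_le)
    then show ?thesis
      by (intro exI[of _ a] exI[of _ 1]) blast
  qed
next
  fix F :: "'n cp_vertex set"
  assume "\<exists>a b. (\<forall>v. a \<bullet> p v \<le> b) \<and> F = {v. a \<bullet> p v = b}"
  then obtain a b where "\<And>v. a \<bullet> p v \<le> b" and F: "F = {v. a \<bullet> p v = b}"
    by blast
  then have "a \<bullet> p v = b" if "(i, False) \<in> F" "(i, True) \<in> F" for i v
    using slack_zero_on_pair[of b a i v] that by simp
  then show "F \<in> cp_faces"
    unfolding cp_faces_iff using F by blast
qed

end

section \<open>Prescribing the values of the functional\<close>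

text \<open>
  Start with equal weights and raise the weight of \<open>a\<close> or of \<open>b\<close>, according to the
  sign of the deviation \<open>D\<close> from the mean \<open>t\<close>, until the deviation is \<open>0\<close>; then normalize.
\<close>

lemma positive_weights_with_mean:
  fixes c :: "'a \<Rightarrow> real"
  assumes "finite A" "a \<in> A" "b \<in> A" "c a < t" "t < c b"
  shows "\<exists>w. (\<forall>v\<in>A. 0 < w v) \<and> sum w A = 1 \<and> (\<Sum>v\<in>A. w v * c v) = t"
proof -
  define D where "D = (\<Sum>v\<in>A. c v - t)"
  obtain x e where x: "x \<in> A" and e: "0 \<le> e" "e * (c x - t) = - D"
  proof (cases "0 \<le> D")
    case True
    then show ?thesis using assms by (intro that[of a "D / (t - c a)"]) (auto simp: field_simps)
  next
    case False
    then show ?thesis using assms by (intro that[of b "- D / (c b - t)"]) (auto simp: field_simps)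
  qed
  define w where "w v = 1 + (if v = x then e else 0)" for v
  have pos: "0 < w v" for v using e(1) by (simp add: w_def)
  then have total: "0 < sum w A" using assms by (intro sum_pos) auto
  have "(\<Sum>v\<in>A. w v * (c v - t)) = D + (\<Sum>v\<in>A. (if v = x then e * (c v - t) else 0))"
    unfolding D_def sum.distrib[symmetric] by (intro sum.cong) (auto simp: w_def algebra_simps)
  also have "\<dots> = 0" using assms(1) x e(2) by simp
  finally have "(\<Sum>v\<in>A. w v * c v) = sum w A * t"
    by (simp add: right_diff_distrib sum_subtractf sum_distrib_right)
  then show ?thesis
    using pos total
    by (intro exI[of _ "\<lambda>v. w v / sum w A"]) (auto simp: sum_divide_distrib[symmetric])
qed

text \<open>
  The functional is the sum of the coordinates.  It has the value \<open>1\<close> on every direction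
  \<open>axis i 1\<close>, so the coordinate of a vertex along its segment has to be the difference between the value
  of the vertex and the value of the crossing point.
\<close>

lemma realization_with_values:
  fixes rk :: "'n::finite \<Rightarrow> nat" and c :: "'n cp_vertex \<Rightarrow> real"
  assumes "inj rk"
    and w_pos: "\<And>i u. u \<in> earlier rk i \<Longrightarrow> 0 < w i u"
    and w_sum: "\<And>i. earlier rk i \<noteq> {} \<Longrightarrow> sum (w i) (earlier rk i) = 1"
    and between: "\<And>i. (c (i, False) - (\<Sum>u\<in>earlier rk i. w i u * c u)) *
                         (c (i, True) - (\<Sum>u\<in>earlier rk i. w i u * c u)) < 0"
  shows "\<exists>Q p (f :: real ^ 'n \<Rightarrow> real). cp_realization Q p \<and> linear f \<and> (\<forall>v. f (p v) = c v)"
proof -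
  define r where "r v = c v - (\<Sum>u\<in>earlier rk (fst v). w (fst v) u * c u)" for v
  define before :: "('n cp_vertex \<times> 'n cp_vertex) set" where "before = inv_image less_than (\<lambda>v. rk (fst v))"
  define p :: "'n cp_vertex \<Rightarrow> real ^ 'n" where "p = wfrec before
     (\<lambda>p v. (\<Sum>u\<in>earlier rk (fst v). w (fst v) u *\<^sub>R p u) + r v *\<^sub>R axis (fst v) 1)"
  have p_eq: "p v = (\<Sum>u\<in>earlier rk (fst v). w (fst v) u *\<^sub>R p u) + r v *\<^sub>R axis (fst v) 1" for v
    unfolding p_def
    by (subst wfrec) (auto simp: before_def cut_apply earlier_def wf_inv_image intro!: sum.cong)
  interpret iterated_bipyramid rk w r p
    by (unfold_locales; (rule p_eq | use assms in \<open>simp add: r_def\<close>))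
  have "linear ((\<bullet>) (1 :: real ^ 'n))"
    by (simp add: bounded_linear.linear bounded_linear_inner_right)
  moreover have "1 \<bullet> p v = c v" for v
  proof (induction "rk (fst v)" arbitrary: v rule: less_induct)
    case less
    have "1 \<bullet> base (fst v) = (\<Sum>u\<in>earlier rk (fst v). w (fst v) u * c u)"
      unfolding base_def inner_sum_right using less by (auto simp: earlier_def intro!: sum.cong)
    then show ?case by (simp add: inner_p r_def)
  qed
  ultimately show ?thesis using bipyramid_realization by blast
qed

text \<open>
  Counting predecessors separates adjacent vertices.  Only opposite vertices can tie, and the
  parity of the number breaks these ties.
\<close>

lemma acyclic_orientation_ranking:
  fixes R :: "('n::finite cp_vertex \<times> 'n cp_vertex) set"
  assumes "cp_orientation R" "acyclic R"
  shows "\<exists>n :: 'n cp_vertex \<Rightarrow> nat. inj n \<and> (\<forall>v w. (v, w) \<in> R \<longrightarrow> n v < n w)"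
proof -
  define N where "N v = card {u. (u, v) \<in> R\<^sup>+}" for v
  have N: "N v < N w" if "(v, w) \<in> R" for v w
  proof -
    have "(v, v) \<notin> R\<^sup>+" using assms(2) unfolding acyclic_def by blast
    then have "{u. (u, v) \<in> R\<^sup>+} \<subset> {u. (u, w) \<in> R\<^sup>+}"
      using that by (blast intro: trancl_into_trancl)
    then show ?thesis unfolding N_def by (intro psubset_card_mono) auto
  qed
  define n where "n v = 2 * N v + of_bool (snd v)" for v
  have "n v < n w" if "(v, w) \<in> R" for v w
    using N[OF that] by (auto simp: n_def of_bool_def)
  moreover have "inj n"
  proof (rule injI)
    fix v w
    assume "n v = n w"
    then have eq: "N v = N w" "snd v = snd w"
      unfolding n_def by (auto simp: of_bool_def split: if_splits) presburger+
    then have "\<not> cp_adj v w"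
      using assms(1) N[of v w] N[of w v] by (auto simp: cp_orientation_def)
    then have "fst v = fst w" using cp_adj_if_fst_neq by blast
    then show "v = w" using eq by (simp add: prod_eq_iff)
  qed
  ultimately show ?thesis by blast
qed

text \<open>
  The rank of a pair is the smaller of its two numbers, and the earlier pairs are the
  candidate for a forbidden set \<open>I\<close>.
\<close>

lemma LP_orientation_if_not_separated:
  fixes R :: "('n::finite cp_vertex \<times> 'n cp_vertex) set"
  assumes orient: "cp_orientation R" and "acyclic R"
    and not_sep: "\<And>I :: 'n set. I \<noteq> {} \<Longrightarrow> I \<noteq> UNIV \<Longrightarrow> \<exists>x y. fst x \<in> I \<and> fst y \<notin> I \<and> (x, y) \<notin> R"
  shows "LP_orientation R"
proof -
  obtain n :: "'n cp_vertex \<Rightarrow> nat" where inj: "inj n" and mono: "\<And>v w. (v, w) \<in> R \<Longrightarrow> n v < n w"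
    using acyclic_orientation_ranking[OF assms(1,2)] by blast
  have R_iff: "(v, w) \<in> R \<longleftrightarrow> n v < n w" if "cp_adj v w" for v w
    using that orient mono[of v w] mono[of w v] unfolding cp_orientation_def by (metis less_asym)
  define rk where "rk i = min (n (i, False)) (n (i, True))" for i
  have rk_le: "rk (fst v) \<le> n v" for v
    by (cases v; cases "snd v") (auto simp: rk_def)
  have rk_attained: "\<exists>v. fst v = i \<and> n v = rk i" for i
    unfolding rk_def by (metis fst_conv min_def)
  have inj_rk: "inj rk"
    using rk_attained inj by (metis injD injI)
  \<comment> \<open>The segment of the first pair crosses the origin, so its interval has to contain \<open>0\<close> inside.\<close>
  define s :: real where "s = real (Min (range n)) + 1 / 2"
  define c where "c v = real (n v) - s" for v
  define hi where "hi i = max (c (i, False)) (c (i, True))" for i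
  have lo_lt_hi: "real (rk i) - s < hi i" for i
  proof -
    have "n (i, False) \<noteq> n (i, True)" using inj by (auto simp: inj_def)
    then show ?thesis by (auto simp: rk_def hi_def c_def)
  qed
  have weights: "\<exists>w. (\<forall>u\<in>earlier rk i. 0 < w u) \<and> sum w (earlier rk i) = 1 \<and>
      real (rk i) - s < (\<Sum>u\<in>earlier rk i. w u * c u) \<and> (\<Sum>u\<in>earlier rk i. w u * c u) < hi i"
    if nonempty: "earlier rk i \<noteq> {}" for i
  proof -
    let ?I = "{j. rk j < rk i}"
    obtain j where j: "j \<in> ?I" using nonempty by (auto simp: earlier_def)
    obtain a where a: "a \<in> earlier rk i" "n a < rk i"
      using rk_attained[of j] j that unfolding earlier_def by (metis mem_Collect_eq)
    \<comment> \<open>An earlier vertex \<open>x\<close> that does not precede some vertex \<open>y\<close> of the other pairs lies above the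
      lower end of the new interval.\<close>
    obtain x y where xy: "fst x \<in> ?I" "fst y \<notin> ?I" "(x, y) \<notin> R"
      using not_sep[of ?I] j by blast
    then have "fst x \<noteq> fst y" by metis
    then have "rk i \<le> n y" "\<not> n x < n y" "n x \<noteq> n y"
      using xy rk_le[of y] R_iff[of x y] cp_adj_if_fst_neq[of x y] inj by (auto dest: injD)
    then have x: "x \<in> earlier rk i" "rk i < n x"
      using xy(1) by (auto simp: earlier_def)
    obtain t where t: "real (rk i) - s < t" "t < min (hi i) (c x)"
      using dense[of "real (rk i) - s" "min (hi i) (c x)"] lo_lt_hi[of i] x(2) by (auto simp: c_def)
    have "c a < t" "t < c x" using t a(2) by (auto simp: c_def)
    from positive_weights_with_mean[OF _ a(1) x(1) this]
    show ?thesis using t by auto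
  qed
  define good where "good i w \<longleftrightarrow> (\<forall>u\<in>earlier rk i. 0 < w u) \<and>
      (earlier rk i \<noteq> {} \<longrightarrow> sum w (earlier rk i) = 1) \<and>
      real (rk i) - s < (\<Sum>u\<in>earlier rk i. w u * c u) \<and>
      (\<Sum>u\<in>earlier rk i. w u * c u) < hi i" for i and w :: "'n cp_vertex \<Rightarrow> real"
  have "\<exists>w. good i w" for i
  proof (cases "earlier rk i = {}")
    case True
    have "rk i \<le> n v" for v
      using True rk_le[of v] by (auto simp: earlier_def not_less intro: order_trans)
    then have "Min (range n) = rk i"
      using rk_attained[of i] by (intro Min_eqI) (auto, metis rangeI)
    moreover have "n (i, False) \<noteq> n (i, True)" using inj by (auto simp: inj_def)
    ultimately have "real (rk i) - s < 0" "0 < hi i"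
      by (auto simp: s_def hi_def c_def rk_def)
    then show ?thesis using True by (auto simp: good_def)
  next
    case False
    then show ?thesis using weights unfolding good_def by blast
  qed
  then obtain w where "\<And>i. good i (w i)" by metis
  then have w: "\<And>i u. u \<in> earlier rk i \<Longrightarrow> 0 < w i u"
    "\<And>i. earlier rk i \<noteq> {} \<Longrightarrow> sum (w i) (earlier rk i) = 1"
    "\<And>i. real (rk i) - s < (\<Sum>u\<in>earlier rk i. w i u * c u)"
    "\<And>i. (\<Sum>u\<in>earlier rk i. w i u * c u) < hi i"
    unfolding good_def by blast+
  have "(c (i, False) - (\<Sum>u\<in>earlier rk i. w i u * c u)) *
        (c (i, True) - (\<Sum>u\<in>earlier rk i. w i u * c u)) < 0" for i
    using w(3)[of i] w(4)[of i]
    by (auto simp: rk_def hi_def c_def mult_less_0_iff min_def max_def split: if_splits)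
  from realization_with_values[OF inj_rk w(1,2) this]
  obtain Q p and f :: "real ^ 'n \<Rightarrow> real" where
    "cp_realization Q p" "linear f" "\<And>v. f (p v) = c v"
    by blast
  moreover have "c v < c w \<longleftrightarrow> n v < n w" "c v = c w \<longleftrightarrow> v = w" for v w
    using inj by (auto simp: c_def inj_def)
  ultimately show ?thesis
    unfolding LP_orientation_def using R_iff
    by (intro exI[of _ Q] exI[of _ p] exI[of _ f]) (auto simp: cp_adj_def)
qed

theorem theorem3:
  fixes R :: "('n::finite cp_vertex \<times> 'n cp_vertex) set"
  assumes "cp_orientation R" and "acyclic R"
  shows "LP_orientation R \<longleftrightarrow>
    \<not> (\<exists>I :: 'n set. I \<noteq> {} \<and> I \<noteq> UNIV \<and>
         (\<forall>x \<in> (\<Union>i\<in>I. cp_pair i). \<forall>y. y \<notin> (\<Union>i\<in>I. cp_pair i) \<longrightarrow>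
            cp_adj x y \<longrightarrow> (x, y) \<in> R))"
proof -
  have sep_iff: "(\<forall>x \<in> (\<Union>i\<in>I. cp_pair i). \<forall>y. y \<notin> (\<Union>i\<in>I. cp_pair i) \<longrightarrow>
            cp_adj x y \<longrightarrow> (x, y) \<in> R) \<longleftrightarrow>
         \<not> (\<exists>x y. fst x \<in> I \<and> fst y \<notin> I \<and> (x, y) \<notin> R)" for I :: "'n set"
    unfolding Ball_def mem_pairs_iff using cp_adj_if_fst_neq by metis
  show ?thesis
    unfolding sep_iff
    using LP_orientation_not_separated[of R] LP_orientation_if_not_separated[OF assms] by blast
qed

end
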